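(* Let $\{x_{mn}\}$ be a double sequence in an intuitionistic fuzzy normed space $(X,\mu,\nu,\star,\circ)$ such that $x_{mn}\xrightarrow{\mathcal{I}_2^{(\mu,\nu)}}L$ (with $L\in X$). Then, for any $\lambda\in(0,1)$, $\Gamma_{(x_{mn})}^r(\mathcal{I}_2^{(\mu,\nu)})=\mathcal{I}_2^{(\mu,\nu)}\text{-}LIM_{x_{mn}}^r$ for some $r>0$.
   Context: $\mathcal{I}_2$ is a fixed non-trivial admissible ideal of subsets of $\mathbb{N}\times\mathbb{N}$: a family containing $\emptyset$, closed under finite unions and under passing to subsets, with $\mathbb{N}\times\mathbb{N}\notin\mathcal{I}_2$ and with every singleton belonging to $\mathcal{I}_2$. A continuous $t$-norm (resp. $t$-conorm) is an associative, commutative, continuous binary operation $\star$ (resp. $\circ$) on $[0,1]$, monotone in each argument, with $x\star 1=x$ (resp. $x\circ 0=x$) for all $x\in[0,1]$. An intuitionistic fuzzy normed space (IFNS) is a 5-tuple $(X,\mu,\nu,\star,\circ)$ where $X$ is a normed linear space, $\star$ is a continuous $t$-norm, $\circ$ is a continuous $t$-conorm, and $\mu,\nu:X\times(0,\infty)\to[0,1]$ satisfy for all $x,y\in X$, $s,t>0$: $\mu(x,t)+\nu(x,t)\le 1$; $\mu(x,t)>0$; $\mu(x,t)=1$ iff $x=0$; $\mu(\alpha x,t)=\mu(x,t/|\alpha|)$ for each scalar $\alpha\ne0$; $\mu(x,t)\star\mu(y,s)\le\mu(x+y,t+s)$; $\mu(x,\cdot)$ is continuous on $(0,\infty)$; $\lim_{t\to\infty}\mu(x,t)=1$,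 and $\lim_{t\to0}\mu(x,t)=0$ for $x\neq 0$; $\nu(x,t)<1$; $\nu(x,t)=0$ iff $x=0$; $\nu(\alpha x,t)=\nu(x,t/|\alpha|)$ for each scalar $\alpha\neq0$; $\nu(x,t)\circ\nu(y,s)\ge\nu(x+y,s+t)$; $\nu(x,\cdot)$ is continuous on $(0,\infty)$; $\lim_{t\to\infty}\nu(x,t)=0$, and $\lim_{t\to0}\nu(x,t)=1$ for $x\ne0$. $x_{mn}\xrightarrow{\mathcal{I}_2^{(\mu,\nu)}}L$ ($\mathcal{I}_2$-convergence) means: for each $\varepsilon>0$ and $t>0$, $\{(m,n)\in\mathbb{N}\times\mathbb{N}:\mu(x_{mn}-L,t)\le1-\varepsilon\text{ or }\nu(x_{mn}-L,t)\ge\varepsilon\}\in\mathcal{I}_2$. For $r\ge0$, $\{x_{mn}\}$ is rough $\mathcal{I}_2$-convergent to $\xi\in X$ if for every $\varepsilon>0$ and $\lambda\in(0,1)$, $\{(m,n)\in\mathbb{N}\times\mathbb{N}:\mu(x_{mn}-\xi,r+\varepsilon)\le1-\lambda\text{ or }\nu(x_{mn}-\xi,r+\varepsilon)\ge\lambda\}\in\mathcal{I}_2$. $\mathcal{I}_2^{(\mu,\nu)}\text{-}LIM_{x_{mn}}^r$ is the set of all such $\xi\in X$. For $r\ge0$, a point $\beta\in X$ is a rough $\mathcal{I}_2$-cluster point of $\{x_{mn}\}$ if for every $\varepsilon>0$ and $\lambda\in(0,1)$, $\{(m,n)\in\mathbb{N}\times\mathbb{N}:\mu(x_{mn}-\beta,r+\varepsilon)>1-\lambda\text{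 and }\nu(x_{mn}-\beta,r+\varepsilon)<\lambda\}\notin\mathcal{I}_2$. $\Gamma_{(x_{mn})}^r(\mathcal{I}_2^{(\mu,\nu)})$ is the set of all rough $\mathcal{I}_2$-cluster points of $\{x_{mn}\}$. The $\lambda$ in the claim's quantifier "for any $\lambda\in(0,1)$" does not occur in the asserted equality. *)

theory Defs
  imports Complex_Main
begin

definition nontrivial_admissible_ideal :: "'i set set \<Rightarrow> bool" where
  "nontrivial_admissible_ideal I \<longleftrightarrow>
     {} \<in> I \<and>
     (\<forall>A\<in>I. \<forall>B\<in>I. A \<union> B \<in> I) \<and>
     (\<forall>A\<in>I. \<forall>B. B \<subseteq> A \<longrightarrow> B \<in> I) \<and>
     UNIV \<notin> I \<and>
     (\<forall>p. {p} \<in> I)"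

text \<open>Operations on the unit interval are represented by functions on the reals of which only the
  values on the unit square matter.\<close>

definition unit_interval_operation :: "(real \<Rightarrow> real \<Rightarrow> real) \<Rightarrow> bool" where
  "unit_interval_operation f \<longleftrightarrow>
     (\<forall>x\<in>{0..1}. \<forall>y\<in>{0..1}. f x y \<in> {0..1}) \<and>
     (\<forall>x\<in>{0..1}. \<forall>y\<in>{0..1}. \<forall>z\<in>{0..1}. f (f x y) z = f x (f y z)) \<and>
     (\<forall>x\<in>{0..1}. \<forall>y\<in>{0..1}. f x y = f y x) \<and>
     continuous_on ({0..1} \<times> {0..1}) (\<lambda>(x, y). f x y) \<and>
     (\<forall>z\<in>{0..1}. mono_on {0..1} (\<lambda>x. f x z) \<and> mono_on {0..1} (\<lambda>x. f z x))"

definition continuous_t_norm :: "(real \<Rightarrow> real \<Rightarrow> real) \<Rightarrow> bool" where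
  "continuous_t_norm f \<longleftrightarrow> unit_interval_operation f \<and> (\<forall>x\<in>{0..1}. f x 1 = x)"

definition continuous_t_conorm :: "(real \<Rightarrow> real \<Rightarrow> real) \<Rightarrow> bool" where
  "continuous_t_conorm f \<longleftrightarrow> unit_interval_operation f \<and> (\<forall>x\<in>{0..1}. f x 0 = x)"

text \<open>The second argument of \<open>\<mu>\<close> and \<open>\<nu>\<close> ranges over the positive reals; values at other arguments
  are irrelevant. Scalars are real; a complex space satisfies these axioms by restriction of
  scalars, so nothing is lost.\<close>

locale intuitionistic_fuzzy_normed_space =
  fixes \<mu> \<nu> :: "'a::real_normed_vector \<Rightarrow> real \<Rightarrow> real"
    and star circ :: "real \<Rightarrow> real \<Rightarrow> real"
  assumes t_norm: "continuous_t_norm star"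
    and t_conorm: "continuous_t_conorm circ"
    and mu_range: "t > 0 \<Longrightarrow> \<mu> x t \<in> {0..1}"
    and nu_range: "t > 0 \<Longrightarrow> \<nu> x t \<in> {0..1}"
    and mu_nu_le_1: "t > 0 \<Longrightarrow> \<mu> x t + \<nu> x t \<le> 1"
    and mu_pos: "t > 0 \<Longrightarrow> \<mu> x t > 0"
    and mu_eq_1_iff: "t > 0 \<Longrightarrow> \<mu> x t = 1 \<longleftrightarrow> x = 0"
    and mu_scale: "t > 0 \<Longrightarrow> \<alpha> \<noteq> 0 \<Longrightarrow> \<mu> (\<alpha> *\<^sub>R x) t = \<mu> x (t / \<bar>\<alpha>\<bar>)"
    and mu_triangle: "s > 0 \<Longrightarrow> t > 0 \<Longrightarrow> star (\<mu> x t) (\<mu> y s) \<le> \<mu> (x + y) (t + s)"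
    and mu_continuous: "continuous_on {0<..} (\<mu> x)"
    and mu_at_top: "(\<mu> x \<longlongrightarrow> 1) at_top"
    and mu_at_0: "x \<noteq> 0 \<Longrightarrow> (\<mu> x \<longlongrightarrow> 0) (at_right 0)"
    and nu_less_1: "t > 0 \<Longrightarrow> \<nu> x t < 1"
    and nu_eq_0_iff: "t > 0 \<Longrightarrow> \<nu> x t = 0 \<longleftrightarrow> x = 0"
    and nu_scale: "t > 0 \<Longrightarrow> \<alpha> \<noteq> 0 \<Longrightarrow> \<nu> (\<alpha> *\<^sub>R x) t = \<nu> x (t / \<bar>\<alpha>\<bar>)"
    and nu_triangle: "s > 0 \<Longrightarrow> t > 0 \<Longrightarrow> circ (\<nu> x t) (\<nu> y s) \<ge> \<nu> (x + y) (s + t)"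
    and nu_continuous: "continuous_on {0<..} (\<nu> x)"
    and nu_at_top: "(\<nu> x \<longlongrightarrow> 0) at_top"
    and nu_at_0: "x \<noteq> 0 \<Longrightarrow> (\<nu> x \<longlongrightarrow> 1) (at_right 0)"

definition I2_convergent ::
  "(nat \<times> nat) set set \<Rightarrow> ('a::real_normed_vector \<Rightarrow> real \<Rightarrow> real) \<Rightarrow> ('a \<Rightarrow> real \<Rightarrow> real) \<Rightarrow>
     (nat \<Rightarrow> nat \<Rightarrow> 'a) \<Rightarrow> 'a \<Rightarrow> bool" where
  "I2_convergent I \<mu> \<nu> x L \<longleftrightarrow>
     (\<forall>\<epsilon>>0. \<forall>t>0. {(m, n). \<mu> (x m n - L) t \<le> 1 - \<epsilon> \<or> \<nu> (x m n - L) t \<ge> \<epsilon>} \<in> I)"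

text \<open>The following two notions are meant for roughness degrees \<open>r \<ge> 0\<close> only.\<close>

definition rough_I2_LIM ::
  "(nat \<times> nat) set set \<Rightarrow> ('a::real_normed_vector \<Rightarrow> real \<Rightarrow> real) \<Rightarrow> ('a \<Rightarrow> real \<Rightarrow> real) \<Rightarrow>
     real \<Rightarrow> (nat \<Rightarrow> nat \<Rightarrow> 'a) \<Rightarrow> 'a set" where
  "rough_I2_LIM I \<mu> \<nu> r x =
     {\<xi>. \<forall>\<epsilon>>0. \<forall>l\<in>{0<..<1}.
        {(m, n). \<mu> (x m n - \<xi>) (r + \<epsilon>) \<le> 1 - l \<or> \<nu> (x m n - \<xi>) (r + \<epsilon>) \<ge> l} \<in> I}"

definition rough_I2_cluster_points ::
  "(nat \<times> nat) set set \<Rightarrow> ('a::real_normed_vector \<Rightarrow> real \<Rightarrow> real) \<Rightarrow> ('a \<Rightarrow> real \<Rightarrow> real) \<Rightarrow>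
     real \<Rightarrow> (nat \<Rightarrow> nat \<Rightarrow> 'a) \<Rightarrow> 'a set" where
  "rough_I2_cluster_points I \<mu> \<nu> r x =
     {\<beta>. \<forall>\<epsilon>>0. \<forall>l\<in>{0<..<1}.
        {(m, n). \<mu> (x m n - \<beta>) (r + \<epsilon>) > 1 - l \<and> \<nu> (x m n - \<beta>) (r + \<epsilon>) < l} \<notin> I}"

end

theory Submission imports Defs "HOL-Analysis.Elementary_Metric_Spaces" begin

text \<open>Since \<open>\<lambda>\<close> is arbitrary while \<open>r\<close> is fixed, a rough cluster point \<open>\<beta>\<close> has terms \<open>x m n\<close> with
  \<open>\<mu> (x m n - \<beta>) (r + 1)\<close> as close to 1 as desired; choosing them outside an exceptional set of the
  ideal, \<open>\<mu> (x m n - L) 1\<close> is close to 1 as well. The triangle inequality and continuity of the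
  t-norm at (1, 1) force \<open>\<mu> (\<beta> - L) (r + 2) = 1\<close>, i.e. \<open>\<beta> = L\<close>. So for every \<open>r \<ge> 0\<close> both sets are \<open>{L}\<close>.\<close>

text \<open>Continuity at (1, 1), where \<open>f 1 1 = 1\<close> exceeds \<open>c\<close>. The bound
  \<open>d < 1\<close> lets \<open>d\<close> serve as the level \<open>l\<close> in the definition
  of rough cluster points.\<close>

lemma continuous_t_norm_near_1:
  assumes "continuous_t_norm f" "c < 1"
  obtains d where "0 < d" "d < 1"
    "\<And>a b. a \<in> {0..1} \<Longrightarrow> b \<in> {0..1} \<Longrightarrow> 1 - d < a \<Longrightarrow> 1 - d < b \<Longrightarrow> c < f a b"
proof -
  have cont: "continuous_on ({0..1} \<times> {0..1}) (\<lambda>(x, y). f x y)" and f11: "f 1 1 = 1"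
    using assms(1) by (auto simp: continuous_t_norm_def unit_interval_operation_def)
  have "\<exists>e>0. \<forall>p\<in>{0..1} \<times> {0..1}. dist p (1, 1) < e \<longrightarrow>
      dist ((\<lambda>(x, y). f x y) p) ((\<lambda>(x, y). f x y) (1, 1)) < 1 - c"
    using cont \<open>c < 1\<close> unfolding continuous_on_iff by (auto simp del: split_paired_Ex)
  then obtain e where "e > 0" and e: "\<And>a b. a \<in> {0..1} \<Longrightarrow> b \<in> {0..1} \<Longrightarrow>
      dist (a, b) (1, 1) < e \<Longrightarrow> dist (f a b) (f 1 1) < 1 - c"
    by fastforce
  show thesis
  proof
    \<comment> \<open>The half of \<open>e\<close> makes the two coordinate distances add up to less
      than \<open>e\<close>; the cap 1/2 keeps the radius below 1.\<close>
    show "0 < min (e / 2) (1 / 2)" "min (e / 2) (1 / 2) < 1"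
      using \<open>e > 0\<close> by auto
    fix a b :: real
    assume ab: "a \<in> {0..1}" "b \<in> {0..1}"
      "1 - min (e / 2) (1 / 2) < a" "1 - min (e / 2) (1 / 2) < b"
    have "dist (a, b) (1, 1) \<le> dist a 1 + dist b 1"
      unfolding dist_Pair_Pair by (rule sqrt_sum_squares_le_sum) auto
    also have "\<dots> < e"
      using ab by (auto simp: dist_real_def)
    finally show "c < f a b"
      using e[OF ab(1,2)] f11 by (auto simp: dist_real_def)
  qed
qed

lemma (in intuitionistic_fuzzy_normed_space) mu_uminus:
  "t > 0 \<Longrightarrow> \<mu> (- x) t = \<mu> x t"
  using mu_scale[of t "-1" x] by simp

lemma (in intuitionistic_fuzzy_normed_space) rough_I2_cluster_point_unique:
  assumes I: "nontrivial_admissible_ideal I" and conv: "I2_convergent I \<mu> \<nu> x L"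
    and "r \<ge> 0" and \<beta>: "\<beta> \<in> rough_I2_cluster_points I \<mu> \<nu> r x"
  shows "\<beta> = L"
proof (rule ccontr)
  assume "\<beta> \<noteq> L"
  \<comment> \<open>The parameter \<open>r + 2\<close> is the sum of \<open>r + 1\<close> (cluster
    condition with \<epsilon> = 1) and 1 (convergence to \<open>L\<close> with t = 1), as the
    triangle inequality will require.\<close>
  then have "\<mu> (\<beta> - L) (r + 2) < 1"
    using mu_range[of "r + 2" "\<beta> - L"] mu_eq_1_iff[of "r + 2" "\<beta> - L"] \<open>r \<ge> 0\<close> by auto
  then obtain d where d: "0 < d" "d < 1"
    and near: "\<And>a b. a \<in> {0..1} \<Longrightarrow> b \<in> {0..1} \<Longrightarrow> 1 - d < a \<Longrightarrow> 1 - d < b \<Longrightarrow>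
      \<mu> (\<beta> - L) (r + 2) < star a b"
    using continuous_t_norm_near_1[OF t_norm] by metis
  define C where "C = {(m, n). \<mu> (x m n - \<beta>) (r + 1) > 1 - d \<and> \<nu> (x m n - \<beta>) (r + 1) < d}"
  define E where "E = {(m, n). \<mu> (x m n - L) 1 \<le> 1 - d \<or> \<nu> (x m n - L) 1 \<ge> d}"
  have "C \<notin> I"
    using \<beta> d unfolding rough_I2_cluster_points_def C_def by auto
  moreover have "E \<in> I"
    using conv d unfolding I2_convergent_def E_def by simp
  \<comment> \<open>Otherwise downward closure of the ideal would put \<open>C\<close> into
    \<open>I\<close>.\<close>
  ultimately have "\<not> C \<subseteq> E"
    using I unfolding nontrivial_admissible_ideal_def by blast
  then obtain m n where mn: "\<mu> (x m n - \<beta>) (r + 1) > 1 - d" "\<mu> (x m n - L) 1 > 1 - d"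
    unfolding C_def E_def by fastforce
  have minus: "\<mu> (\<beta> - x m n) (r + 1) = \<mu> (x m n - \<beta>) (r + 1)"
    using mu_uminus[of "r + 1" "x m n - \<beta>"] \<open>r \<ge> 0\<close> by simp
  have "star (\<mu> (x m n - L) 1) (\<mu> (\<beta> - x m n) (r + 1)) \<le> \<mu> (\<beta> - L) (r + 2)"
    using mu_triangle[of "r + 1" 1 "x m n - L" "\<beta> - x m n"] \<open>r \<ge> 0\<close> by (simp add: add.commute)
  moreover have "\<mu> (\<beta> - L) (r + 2) < star (\<mu> (x m n - L) 1) (\<mu> (\<beta> - x m n) (r + 1))"
    using \<open>r \<ge> 0\<close> mn minus by (intro near mu_range) auto
  ultimately show False
    by simp
qed

text \<open>For \<epsilon> > 0 the number \<open>r + \<epsilon>\<close> is itself an admissible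
  parameter t in the definition of convergence.\<close>

lemma I2_limit_in_rough_I2_LIM:
  assumes "I2_convergent I \<mu> \<nu> x L" "r \<ge> 0"
  shows "L \<in> rough_I2_LIM I \<mu> \<nu> r x"
  using assms unfolding I2_convergent_def rough_I2_LIM_def by auto

text \<open>The sets in the two definitions are complementary, and a set and its complement cannot
  both lie in \<open>I\<close>, since their union \<open>UNIV\<close> does not.\<close>

lemma rough_I2_LIM_subset_cluster_points:
  assumes I: "nontrivial_admissible_ideal I"
  shows "rough_I2_LIM I \<mu> \<nu> r x \<subseteq> rough_I2_cluster_points I \<mu> \<nu> r x"
proof -
  have compl: "- A \<notin> I" if "A \<in> I" for A
    using I that unfolding nontrivial_admissible_ideal_def by (metis Compl_partition)
  have "{(m, n). \<mu> (x m n - \<xi>) t > 1 - l \<and> \<nu> (x m n - \<xi>) t < l} \<notin> I"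
    if "{(m, n). \<mu> (x m n - \<xi>) t \<le> 1 - l \<or> \<nu> (x m n - \<xi>) t \<ge> l} \<in> I" for \<xi> t l
  proof -
    have "- {(m, n). \<mu> (x m n - \<xi>) t \<le> 1 - l \<or> \<nu> (x m n - \<xi>) t \<ge> l} =
        {(m, n). \<mu> (x m n - \<xi>) t > 1 - l \<and> \<nu> (x m n - \<xi>) t < l}"
      by auto
    then show ?thesis
      using compl[OF that] by metis
  qed
  then show ?thesis
    unfolding rough_I2_LIM_def rough_I2_cluster_points_def by blast
qed

theorem theorem3p13:
  fixes I :: "(nat \<times> nat) set set"
    and \<mu> \<nu> :: "'a::real_normed_vector \<Rightarrow> real \<Rightarrow> real"
    and star circ :: "real \<Rightarrow> real \<Rightarrow> real"
    and x :: "nat \<Rightarrow> nat \<Rightarrow> 'a" and L :: 'a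
  assumes "nontrivial_admissible_ideal I"
    and "intuitionistic_fuzzy_normed_space \<mu> \<nu> star circ"
    and "I2_convergent I \<mu> \<nu> x L"
  shows "\<forall>l::real. 0 < l \<and> l < 1 \<longrightarrow>
           (\<exists>r>0. rough_I2_cluster_points I \<mu> \<nu> r x = rough_I2_LIM I \<mu> \<nu> r x)"
proof -
  interpret intuitionistic_fuzzy_normed_space \<mu> \<nu> star circ
    by fact
  \<comment> \<open>The witness \<open>r = 1\<close> is an arbitrary positive choice, the same for
    every \<open>l\<close>.\<close>
  have "rough_I2_cluster_points I \<mu> \<nu> 1 x \<subseteq> rough_I2_LIM I \<mu> \<nu> 1 x"
    using rough_I2_cluster_point_unique[OF assms(1,3), of 1]
      I2_limit_in_rough_I2_LIM[OF assms(3), of 1] by auto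
  then have "rough_I2_cluster_points I \<mu> \<nu> 1 x = rough_I2_LIM I \<mu> \<nu> 1 x"
    using rough_I2_LIM_subset_cluster_points[OF assms(1)] by blast
  then show ?thesis
    using zero_less_one by blast
qed

end
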